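(* Let $q>2$ be an odd integer. Then $$\lim_{n\to\infty}\frac{f_{2,q}(n+1)}{f_{2,q}(n)}=1.$$
   Context: $\mathbb{N}$ denotes the set of nonnegative integers. For an odd integer $q>2$, $f_{2,q}(n)$ denotes the number of different expressions of the positive integer $n$ as a sum of distinct terms taken from $\{2^{\alpha}q^{\beta}:\alpha,\beta\in\mathbb{N}\}$ (i.e. the number of finite subsets of this set whose elements sum to $n$). *)

theory Defs
  imports "HOL-Analysis.Analysis"
begin

definition pq_terms :: "nat \<Rightarrow> nat \<Rightarrow> nat set" where
  "pq_terms p q = {p ^ \<alpha> * q ^ \<beta> | \<alpha> \<beta>. True}"

definition num_reps :: "nat \<Rightarrow> nat \<Rightarrow> nat \<Rightarrow> nat" where
  "num_reps p q n = card {S. finite S \<and> S \<subseteq> pq_terms p q \<and> \<Sum>S = n}"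

text \<open>The family counted by \<^const>\<open>num_reps\<close> is finite, so \<^const>\<open>card\<close> is a genuine count.\<close>

lemma finite_reps: "finite {S. finite S \<and> S \<subseteq> pq_terms p q \<and> \<Sum>S = n}"
proof (rule finite_subset)
  show "{S. finite S \<and> S \<subseteq> pq_terms p q \<and> \<Sum>S = n} \<subseteq> Pow {..n}"
    by (auto intro: member_le_sum[where f = "\<lambda>x::nat. x", simplified])
qed simp

end

theory Submission
  imports Defs "HOL-Library.Nat_Bijection"
begin

text \<open>
  Split a representation of \<open>n\<close> into its powers of two and its multiples of \<open>q\<close>. The powers of two
  may have any sum \<open>n - q j \<ge> 0\<close>, and then binary expansion determines them; dividing the rest by
  \<open>q\<close> leaves an arbitrary representation of \<open>j\<close>. Hence \<open>f(n) = \<Sum>j\<le>n div q. f(j)\<close>: the function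
  counts partitions into powers of \<open>q\<close>. In particular \<open>f\<close> is constant on the blocks
  \<open>{qk, \<dots>, qk + q - 1}\<close> and \<open>f(qk) - f(qk - 1) = f(k)\<close>. If \<open>f(n+1) \<le> (1 + \<delta>) f(n)\<close> for large
  \<open>n\<close>, then the sum of \<open>f\<close> over a block is at least \<open>q/\<delta>\<close> times the jump at the end of that block;
  telescoping gives \<open>f(qk - 1) = \<Sum>j<k. f(j) \<ge> (q/\<delta>)(f(k) - C)\<close>, which improves \<open>\<delta>\<close> to any
  constant above \<open>\<delta>/q\<close>. Iterating drives \<open>\<delta>\<close> to \<open>0\<close>.
\<close>

section \<open>Splitting a representation into powers of two and multiples of
  \<open>q\<close>\<close>

definition pq_reps :: "nat \<Rightarrow> nat \<Rightarrow> nat \<Rightarrow> nat set set" where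
  "pq_reps p q n = {S. finite S \<and> S \<subseteq> pq_terms p q \<and> \<Sum>S = n}"

lemma num_reps_eq_card: "num_reps p q n = card (pq_reps p q n)"
  by (simp add: num_reps_def pq_reps_def)

lemma pq_terms_unfold: "pq_terms p q = range ((^) p) \<union> (*) q ` pq_terms p q"
proof (intro equalityI subsetI)
  fix x assume "x \<in> pq_terms p q"
  then obtain a b where x: "x = p ^ a * q ^ b"
    by (auto simp: pq_terms_def)
  show "x \<in> range ((^) p) \<union> (*) q ` pq_terms p q"
  proof (cases b)
    case 0
    then show ?thesis using x by simp
  next
    case (Suc c)
    then have "x = q * (p ^ a * q ^ c)" using x by simp
    then show ?thesis unfolding pq_terms_def by blast
  qed
next
  fix x assume "x \<in> range ((^) p) \<union> (*) q ` pq_terms p q"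
  then consider a where "x = p ^ a * q ^ 0" | a b where "x = p ^ a * q ^ Suc b"
    by (fastforce simp: pq_terms_def)
  then show "x \<in> pq_terms p q"
    unfolding pq_terms_def by cases blast+
qed

definition pow2_set :: "nat \<Rightarrow> nat set" where
  "pow2_set m = (^) 2 ` set_decode m"

lemma inj_power2: "inj ((^) (2::nat))"
  by (simp add: inj_on_def)

lemma finite_pow2_set: "finite (pow2_set m)"
  by (simp add: pow2_set_def)

lemma sum_pow2_set: "\<Sum>(pow2_set m) = m"
proof -
  have "\<Sum>(pow2_set m) = set_encode (set_decode m)"
    unfolding pow2_set_def set_encode_def
    by (subst sum.reindex) (auto intro: inj_on_subset[OF inj_power2])
  then show ?thesis by simp
qed

text \<open>Uniqueness of binary expansion, inherited from \<open>set_encode\<close> being inverted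
  by \<open>set_decode\<close> on finite sets.\<close>

lemma pow2_set_unique:
  assumes "finite A" "A \<subseteq> range ((^) 2)"
  shows "A = pow2_set (\<Sum>A)"
proof -
  obtain B where B: "A = (^) 2 ` B"
    using assms(2) by (auto simp: subset_image_iff)
  have fin: "finite B"
    using assms(1) B by (metis finite_imageD inj_on_subset[OF inj_power2] subset_UNIV)
  have "\<Sum>A = set_encode B"
    unfolding B set_encode_def by (subst sum.reindex) (auto intro: inj_on_subset[OF inj_power2])
  then show ?thesis
    using fin by (simp add: B pow2_set_def)
qed

text \<open>Every divisor of a power of two is itself a power of two, and the only odd one is 1.
  This keeps the two parts of a representation disjoint.\<close>

lemma power2_ne_odd_mult:
  fixes q :: nat
  assumes "q > 2" "odd q"
  shows "2 ^ a \<noteq> q * x"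
proof
  assume "2 ^ a = q * x"
  then have "q dvd 2 ^ a" by simp
  then obtain i where "q = 2 ^ i"
    using divides_primepow_nat[of 2 q a] by auto
  with assms show False by (cases i) auto
qed

lemma num_reps_recurrence:
  fixes q :: nat
  assumes q: "q > 2" "odd q"
  shows "num_reps 2 q n = (\<Sum>j\<le>n div q. num_reps 2 q j)"
proof -
  \<comment> \<open>\<open>F\<close> assembles a representation of \<open>n\<close> from
    \<open>j\<close> and \<open>T\<close>. \<open>G\<close> recovers \<open>T\<close> as the
    preimage under multiplication by \<open>q\<close>, and \<open>j\<close> as the sum of
    \<open>T\<close>.\<close>
  define F where "F = (\<lambda>(j, T). pow2_set (n - q * j) \<union> (*) q ` T)"
  define G where "G = (\<lambda>S. (\<Sum>{x. q * x \<in> S}, {x. q * x \<in> S}))"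
  have injq: "inj ((*) q)" using q by (simp add: inj_on_def)
  have pre: "{x. q * x \<in> pow2_set m \<union> (*) q ` T} = T" for m T
  proof -
    have "q * x \<notin> pow2_set m" for x
      using power2_ne_odd_mult[OF q] by (metis imageE pow2_set_def)
    then show ?thesis using injq by (auto dest: injD)
  qed
  have sumq: "\<Sum>((*) q ` T) = q * \<Sum>T" for T
    by (subst sum.reindex) (auto intro: inj_on_subset[OF injq] simp: sum_distrib_left)
  have "bij_betw F (SIGMA j:{..n div q}. pq_reps 2 q j) (pq_reps 2 q n)"
  proof (rule bij_betw_byWitness[where f' = G])
    show "\<forall>a\<in>SIGMA j:{..n div q}. pq_reps 2 q j. G (F a) = a"
      unfolding F_def G_def by (clarify, simp only: split_conv pre) (simp add: pq_reps_def)
  next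
    \<comment> \<open>One claim serves twice: it shows that \<open>F\<close> undoes \<open>G\<close>
      and that \<open>G\<close> lands in the index set.\<close>
    have split: "pow2_set (n - q * \<Sum>{x. q * x \<in> S}) \<union> (*) q ` {x. q * x \<in> S} = S
        \<and> \<Sum>{x. q * x \<in> S} \<le> n div q \<and> {x. q * x \<in> S} \<in> pq_reps 2 q (\<Sum>{x. q * x \<in> S})"
      if S: "S \<in> pq_reps 2 q n" for S
    proof -
      define U where "U = {x. q * x \<in> S}"
      define A where "A = S - (*) q ` U"
      have fS: "finite S" and sub: "S \<subseteq> pq_terms 2 q" and sS: "\<Sum>S = n"
        using S by (auto simp: pq_reps_def)
      have US: "(*) q ` U \<subseteq> S" by (auto simp: U_def)
      have fU: "finite U"
        using finite_subset[OF US fS] inj_on_subset[OF injq] by (metis finite_imageD subset_UNIV)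
      have UT: "U \<subseteq> pq_terms 2 q"
      proof
        fix x assume "x \<in> U"
        then have "q * x \<in> range ((^) 2) \<union> (*) q ` pq_terms 2 q"
          using sub pq_terms_unfold[of 2 q] by (auto simp: U_def)
        then show "x \<in> pq_terms 2 q"
          using power2_ne_odd_mult[OF q] q by (metis UnE imageE injD[OF injq])
      qed
      have A2: "A \<subseteq> range ((^) 2)"
        using sub pq_terms_unfold[of 2 q] by (auto simp: A_def U_def)
      have sum: "\<Sum>A + q * \<Sum>U = n"
        using sum.subset_diff[OF US fS, of "\<lambda>x. x"] sS sumq[of U] by (simp add: A_def)
      \<comment> \<open>The sum of \<open>A\<close> is fixed by that of \<open>U\<close>, so binary
        uniqueness determines \<open>A\<close>.\<close>
      then have "A = pow2_set (n - q * \<Sum>U)"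
        using pow2_set_unique[OF _ A2] fS by (metis A_def add_diff_cancel_right' finite_Diff)
      moreover have "\<Sum>U \<le> n div q"
        using sum q by (simp add: less_eq_div_iff_mult_less_eq mult.commute)
      ultimately show ?thesis
        using US fU UT unfolding U_def[symmetric] by (auto simp: A_def pq_reps_def)
    qed
    show "\<forall>S\<in>pq_reps 2 q n. F (G S) = S"
      using split by (auto simp: F_def G_def)
    show "G ` pq_reps 2 q n \<subseteq> (SIGMA j:{..n div q}. pq_reps 2 q j)"
      using split by (auto simp: G_def)
  next
    show "F ` (SIGMA j:{..n div q}. pq_reps 2 q j) \<subseteq> pq_reps 2 q n"
    proof (rule image_subsetI)
      fix x assume "x \<in> (SIGMA j:{..n div q}. pq_reps 2 q j)"
      then obtain j T where x: "x = (j, T)" and j: "j \<le> n div q" and T: "T \<in> pq_reps 2 q j"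
        by auto
      have "q * j \<le> n"
        using j q by (simp add: less_eq_div_iff_mult_less_eq mult.commute)
      moreover have "pow2_set (n - q * j) \<inter> (*) q ` T = {}"
        using power2_ne_odd_mult[OF q] by (auto simp: pow2_set_def)
      ultimately have "\<Sum>(pow2_set (n - q * j) \<union> (*) q ` T) = n"
        using T by (simp add: sum.union_disjoint finite_pow2_set sum_pow2_set sumq pq_reps_def)
      moreover have "pow2_set (n - q * j) \<union> (*) q ` T \<subseteq> pq_terms 2 q"
        using T pq_terms_unfold[of 2 q] by (auto simp: pow2_set_def pq_reps_def)
      ultimately show "F x \<in> pq_reps 2 q n"
        using T by (simp add: x F_def pq_reps_def finite_pow2_set)
    qed
  qed
  then have "card (pq_reps 2 q n) = card (SIGMA j:{..n div q}. pq_reps 2 q j)"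
    by (simp add: bij_betw_same_card)
  also have "\<dots> = (\<Sum>j\<le>n div q. card (pq_reps 2 q j))"
    by (rule card_SigmaI) (auto simp: pq_reps_def finite_reps)
  finally show ?thesis
    by (simp add: num_reps_eq_card)
qed

lemma num_reps_0: "num_reps p q 0 > 0"
proof -
  have "{} \<in> pq_reps p q 0" by (simp add: pq_reps_def)
  then show ?thesis
    by (auto simp: num_reps_eq_card card_gt_0_iff pq_reps_def finite_reps)
qed

section \<open>Growth of positive solutions of the recurrence\<close>

locale block_sum_recurrence =
  fixes g :: "nat \<Rightarrow> real" and q :: nat
  assumes q: "q \<ge> 3"
    and rec: "g n = (\<Sum>j\<le>n div q. g j)"
    and pos0: "g 0 > 0"
begin

lemma pos: "g n > 0"
proof (induction n rule: less_induct)
  case (less n)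
  show ?case
  \<comment> \<open>At 0 the recurrence only says \<open>g 0 = g 0\<close>, so positivity there
    comes from \<open>pos0\<close>.\<close>
  proof (cases "n = 0")
    case False
    then have "n div q < n" using q by simp
    then have "g j > 0" if "j \<le> n div q" for j
      using less that by simp
    then show ?thesis by (subst rec) (auto intro!: sum_pos)
  qed (simp add: pos0)
qed

lemma mono: "m \<le> n \<Longrightarrow> g m \<le> g n"
  by (subst (1 2) rec) (auto intro!: sum_mono2 div_le_mono simp: less_imp_le pos)

lemma block: "r < q \<Longrightarrow> g (q * k + r) = g (q * k)"
  using q by (subst (1 2) rec) simp

text \<open>Here \<open>n\<close> ends one block and \<open>Suc n\<close> starts the next, so the
  quotients by \<open>q\<close> are \<open>k - 1\<close> and \<open>k\<close>, and the two sums
  differ by the term \<open>g k\<close>.\<close>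

lemma increment_at_multiple:
  assumes "Suc n = q * k"
  shows "g n = (\<Sum>j<k. g j)" and "g (Suc n) = g n + g k"
proof -
  obtain l where k: "k = Suc l" using assms by (cases k) auto
  have "n = (q - 1) + q * l" using assms k q by simp
  then have "n div q = l" using q by (simp only: div_mult_self2) simp
  then show n: "g n = (\<Sum>j<k. g j)"
    by (subst rec) (simp add: k lessThan_Suc_atMost)
  have "g (Suc n) = (\<Sum>j\<le>k. g j)"
    using assms q by (subst rec) simp
  then show "g (Suc n) = g n + g k"
    by (simp add: n flip: lessThan_Suc_atMost)
qed

lemma no_increment: "\<not> q dvd Suc n \<Longrightarrow> g (Suc n) = g n"
  by (subst (1 2) rec) (simp add: div_Suc dvd_eq_mod_eq_0)

text \<open>Each of the \<open>n div q + 1\<close> summands is at least \<open>g 0\<close>, which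
  gives linear growth. Divergence later absorbs the constant \<open>g (q * N)\<close>.\<close>

lemma diverges: "filterlim g at_top sequentially"
proof (rule filterlim_at_top_mono)
  show "filterlim (\<lambda>n. g 0 / q * real n) at_top sequentially"
    using pos0 q by (intro filterlim_tendsto_pos_mult_at_top[OF tendsto_const]
        filterlim_real_sequentially) simp
  have "g 0 / q * real n \<le> g n" for n
  proof -
    have "n \<le> q * (n div q + 1)"
      using q dividend_less_times_div[of q n] by simp
    then have "real n \<le> real q * real (n div q + 1)"
      by (metis of_nat_le_iff of_nat_mult)
    then have "g 0 * (real n / q) \<le> g 0 * real (n div q + 1)"
      using pos0 q by (intro mult_left_mono) (auto simp: field_simps)
    also have "\<dots> = (\<Sum>j\<le>n div q. g 0)" by simp
    also have "\<dots> \<le> (\<Sum>j\<le>n div q. g j)" by (intro sum_mono mono) simp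
    also have "\<dots> = g n" by (rule rec[symmetric])
    finally show ?thesis by simp
  qed
  then show "\<forall>\<^sub>F n in sequentially. g 0 / q * real n \<le> g n" by simp
qed

text \<open>Passing from \<open>K\<close> to \<open>Suc K\<close> adds \<open>q\<close> equal terms
  \<open>g (q * K)\<close> to the sum, while the jump of \<open>g\<close> is at most
  \<open>\<delta>\<close> times one of them.\<close>

lemma telescoped_blocks:
  assumes N: "\<And>n. n \<ge> N \<Longrightarrow> g (Suc n) \<le> (1 + \<delta>) * g n"
    and "\<delta> > 0" and "N \<le> K"
  shows "q * (g (q * K) - g (q * N)) \<le> \<delta> * (\<Sum>j<q * K. g j)"
  using \<open>N \<le> K\<close>
proof (induction K rule: dec_induct)
  case base
  show ?case using \<open>\<delta> > 0\<close> by (simp add: sum_nonneg pos less_imp_le)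
next
  case (step K)
  have "K \<le> q * K" using q by simp
  then have "g (Suc (q * K + (q - 1))) \<le> (1 + \<delta>) * g (q * K + (q - 1))"
    using step.hyps by (intro N) linarith
  moreover have "Suc (q * K + (q - 1)) = q * Suc K" using q by simp
  moreover have "g (q * K + (q - 1)) = g (q * K)" using q by (intro block) simp
  ultimately have jump: "g (q * Suc K) - g (q * K) \<le> \<delta> * g (q * K)"
    by (simp add: algebra_simps)
  have split: "(\<Sum>j<q * K + r. g j) = (\<Sum>j<q * K. g j) + (\<Sum>i<r. g (q * K + i))" for r
    by (induction r) (simp_all add: add.assoc)
  have "(\<Sum>j<q * Suc K. g j) = (\<Sum>j<q * K. g j) + (\<Sum>r<q. g (q * K + r))"
    using split[of q] by (simp add: add.commute)
  also have "\<dots> = (\<Sum>j<q * K. g j) + q * g (q * K)"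
    by (simp add: block)
  finally have "\<delta> * (\<Sum>j<q * Suc K. g j) = \<delta> * (\<Sum>j<q * K. g j) + q * (\<delta> * g (q * K))"
    by (simp add: algebra_simps)
  moreover have "q * (g (q * Suc K) - g (q * K)) \<le> q * (\<delta> * g (q * K))"
    by (intro mult_left_mono jump) simp
  ultimately show ?case
    using step.IH by (simp only: right_diff_distrib)
qed

text \<open>The ideal gain is a factor \<open>1 / q\<close>, at most 1/3. Absorbing the constant
  \<open>g (q * N)\<close> costs a factor 2, whence 2/3.\<close>

lemma improve_ratio_bound:
  assumes ev: "\<forall>\<^sub>F n in sequentially. g (Suc n) \<le> (1 + \<delta>) * g n" and \<delta>: "\<delta> > 0"
  shows "\<forall>\<^sub>F n in sequentially. g (Suc n) \<le> (1 + 2 / 3 * \<delta>) * g n"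
proof -
  obtain N where N: "\<And>n. n \<ge> N \<Longrightarrow> g (Suc n) \<le> (1 + \<delta>) * g n"
    using ev by (auto simp: eventually_sequentially)
  obtain M where M: "\<And>n. n \<ge> M \<Longrightarrow> g n \<ge> 2 * g (q * N)"
    using diverges by (auto simp: filterlim_at_top eventually_sequentially)
  \<comment> \<open>The threshold forces \<open>k\<close>, the quotient of \<open>Suc n\<close> by
    \<open>q\<close>, above both \<open>M\<close> and \<open>q * N\<close>; the latter gives
    \<open>N \<le> k div q\<close>.\<close>
  have "g (Suc n) \<le> (1 + 2 / 3 * \<delta>) * g n" if n: "n \<ge> q * (M + q * N)" for n
  proof (cases "q dvd Suc n")
    case False
    then show ?thesis using no_increment \<delta> pos[of n] by (simp add: algebra_simps)
  next
    case True
    then obtain k where k: "Suc n = q * k" by blast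
    have "q * (M + q * N) < q * k" using n k by linarith
    then have ge: "k \<ge> M" "k \<ge> q * N" by auto
    have "N \<le> k div q"
      using ge q by (simp add: less_eq_div_iff_mult_less_eq mult.commute)
    then have "q * (g (q * (k div q)) - g (q * N)) \<le> \<delta> * (\<Sum>j<q * (k div q). g j)"
      by (intro telescoped_blocks N \<delta>)
    also have "\<dots> \<le> \<delta> * (\<Sum>j<k. g j)"
      using \<delta> by (intro mult_left_mono sum_mono2) (auto simp: pos less_imp_le intro: less_le_trans)
    also have "(\<Sum>j<k. g j) = g n"
      using increment_at_multiple(1)[OF k] by simp
    \<comment> \<open>\<open>k\<close> lies in the block starting at
      \<open>q * (k div q)\<close>.\<close>
    also have "g (q * (k div q)) = g k"
      using block[of "k mod q" "k div q"] q by simp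
    finally have *: "q * (g k - g (q * N)) \<le> \<delta> * g n" .
    \<comment> \<open>By the choice of \<open>M\<close>, the subtracted constant is at most half of
      \<open>g k\<close>.\<close>
    have "3 * (g k / 2) \<le> q * (g k - g (q * N))"
      using q M[OF ge(1)] pos[of k] by (intro mult_mono) auto
    then show ?thesis
      using * increment_at_multiple(2)[OF k] by (simp add: algebra_simps)
  qed
  then show ?thesis by (auto simp: eventually_sequentially)
qed

text \<open>The iteration starts at \<open>\<delta> = 1\<close>: a jump equals \<open>g k\<close>
  with \<open>k \<le> n\<close>, hence is at most \<open>g n\<close> by monotonicity.\<close>

lemma ratio_bound_power: "\<forall>\<^sub>F n in sequentially. g (Suc n) \<le> (1 + (2 / 3) ^ i) * g n"
proof (induction i)
  case 0
  have "g (Suc n) \<le> 2 * g n" for n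
  proof (cases "q dvd Suc n")
    case False
    then show ?thesis using no_increment pos[of n] by simp
  next
    case True
    then obtain k where k: "Suc n = q * k" by blast
    then have "k > 0" by (cases k) auto
    moreover have "2 * k \<le> q * k" using q by (intro mult_right_mono) auto
    ultimately have "k \<le> n" using k by linarith
    then show ?thesis using mono[of k n] increment_at_multiple(2)[OF k] by simp
  qed
  then show ?case by simp
next
  case (Suc i)
  from improve_ratio_bound[OF this] show ?case by simp
qed

lemma ratio_tendsto_1: "(\<lambda>n. g (Suc n) / g n) \<longlonglongrightarrow> 1"
proof (rule order_tendstoI)
  fix a :: real assume "a < 1"
  moreover have "1 \<le> g (Suc n) / g n" for n
    using mono[of n "Suc n"] pos[of n] by simp
  ultimately have "a < g (Suc n) / g n" for n by (meson less_le_trans)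
  then show "\<forall>\<^sub>F n in sequentially. a < g (Suc n) / g n" by simp
next
  fix a :: real assume "1 < a"
  then obtain i where i: "(2 / 3 :: real) ^ i < a - 1"
    using real_arch_pow_inv[of "a - 1" "2 / 3"] by auto
  show "\<forall>\<^sub>F n in sequentially. g (Suc n) / g n < a"
    using ratio_bound_power[of i]
  proof eventually_elim
    case (elim n)
    also have "(1 + (2 / 3) ^ i) * g n < a * g n"
      using i pos[of n] by (intro mult_strict_right_mono) auto
    finally show ?case using pos[of n] by (simp add: field_simps)
  qed
qed

end

theorem theorem4:
  fixes q :: nat
  assumes "q > 2" and "odd q"
  shows "(\<lambda>n. real (num_reps 2 q (n + 1)) / real (num_reps 2 q n)) \<longlonglongrightarrow> 1"
proof -
  interpret block_sum_recurrence "\<lambda>n. real (num_reps 2 q n)" q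
  proof
    show "real (num_reps 2 q n) = (\<Sum>j\<le>n div q. real (num_reps 2 q j))" for n
      by (subst num_reps_recurrence[OF assms]) simp
  qed (use assms num_reps_0 in auto)
  show ?thesis using ratio_tendsto_1 by simp
qed

end
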